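(* Let $(f_\alpha)_{\alpha>0}$ be a regularizing filter, $(u_\lambda,v_\lambda,\kappa_\lambda)_{\lambda\in\Lambda}$ a diagonal frame decomposition (DFD) of $\mathbf K$, $(\bar u_\lambda)_{\lambda\in\Lambda}$ a dual frame of $(u_\lambda)_{\lambda\in\Lambda}$, and let $\mathbf F_\alpha y=\sum_{\lambda\in\Lambda}f_\alpha(\kappa_\lambda)\langle y,v_\lambda\rangle\bar u_\lambda$ (for $y\in\mathbb Y$, $\alpha>0$) be the associated filtered DFD. For given numbers $\rho,\mu>0$ and some constant $C_\mu$ suppose that (R1) $\|f_\alpha\|_\infty=\mathcal O(\alpha^{-1/2})$ as $\alpha\to0$; (R2) $\sup\{\kappa^{2\mu}\,|1-\kappa f_\alpha(\kappa)|\mid\kappa\in(0,\infty)\}\le C_\mu\,\alpha^{\mu}$ for all $\alpha>0$; (R3) $\alpha^*\colon(0,\infty)\times\mathbb Y\to(0,\infty)$ is a parameter choice with $\alpha^*(\delta,y^\delta)\asymp(\delta/\rho)^{2/(2\mu+1)}$. Suppose $x^{+}\in\operatorname{dom}(\mathbf K)\cap(\ker\mathbf K)^\perp$ satisfies the source-type condition that there exists $\boldsymbol\omega=(\omega_\lambda)_{\lambda\in\Lambda}\in\ell^2(\Lambda)$ with $$\|\boldsymbol\omega\|_2\le\rho\quad\text{and}\quad\langle x^{+},u_\lambda\rangle=\kappa_\lambda^{2\mu}\,\omega_\lambda\ \text{ for all }\lambda\in\Lambda .$$ Then there is a constant $c_\mu$ such that for all sufficiently small $\delta>0$ and all $y^\delta\in\mathbb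 Y$ with $\|y^\delta-\mathbf Kx^{+}\|\le\delta$, $$\|x^{+}-\mathbf F_{\alpha^*(\delta,y^\delta)}(y^\delta)\|\le c_\mu\,\delta^{\frac{2\mu}{2\mu+1}}\,\rho^{\frac{1}{2\mu+1}} .$$
   Context: $\mathbb X,\mathbb Y$ are Hilbert spaces over $\mathbb R$ or $\mathbb C$, and $\mathbf K\colon\operatorname{dom}(\mathbf K)\subseteq\mathbb X\to\mathbb Y$ is a closed, densely defined (possibly unbounded) linear operator. $\Lambda$ is an at most countable index set. Frames: a family $(u_\lambda)_{\lambda\in\Lambda}$ in a Hilbert space $\mathbb U$ is a frame for $\mathbb U$ if there are $A,B>0$ with $A\|x\|^2\le\sum_{\lambda}|\langle u_\lambda,x\rangle|^2\le B\|x\|^2$ for all $x\in\mathbb U$. A frame $(\bar u_\lambda)_\lambda$ for $\mathbb U$ is a dual frame of $(u_\lambda)_\lambda$ if $x=\sum_\lambda\langle x,u_\lambda\rangle\bar u_\lambda$ for all $x\in\mathbb U$. DFD: $(u_\lambda,v_\lambda,\kappa_\lambda)_{\lambda\in\Lambda}$ is a DFD for $\mathbf K$ if $(u_\lambda)_\lambda$ is a frame for $(\ker\mathbf K)^\perp$, $(v_\lambda)_\lambda$ is a frame for $\overline{\operatorname{ran}\mathbf K}$, $\kappa_\lambda\in(0,\infty)$ for all $\lambda$, and $v_\lambda\in\operatorname{dom}(\mathbf K^* )$ with $\mathbf K^*v_\lambda=\kappa_\lambda u_\lambda$ for all $\lambda$. The dual frame $(\bar u_\lambda)_\lambda$ is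 a dual frame in $(\ker\mathbf K)^\perp$. Regularizing filter: a family $(f_\alpha)_{\alpha>0}$ of piecewise continuous functions $f_\alpha\colon(0,\infty)\to\mathbb R$ such that (i) $\|f_\alpha\|_\infty=\sup_{\kappa>0}|f_\alpha(\kappa)|<\infty$ for every $\alpha>0$; (ii) there is $C>0$ with $|\kappa f_\alpha(\kappa)|\le C$ for all $\alpha>0$, $\kappa>0$; (iii) $\lim_{\alpha\to0}f_\alpha(\kappa)=1/\kappa$ for every $\kappa\in(0,\infty)$. The notation $\alpha^*(\delta,y^\delta)\asymp(\delta/\rho)^{2/(2\mu+1)}$ means that there are constants $0<c_1\le c_2$, independent of $\delta$ and $y^\delta$, with $c_1(\delta/\rho)^{2/(2\mu+1)}\le\alpha^*(\delta,y^\delta)\le c_2(\delta/\rho)^{2/(2\mu+1)}$. The constant $c_\mu$ may depend on $\mu$ and on the fixed data (the DFD, the dual frame, the filter, and the constants in (R1), (R2), (R3)), but not on $\delta$, $y^\delta$ or $x^{+}$. *)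

theory Defs
  imports "HOL-Analysis.Analysis" "HOL-Library.Landau_Symbols"
begin

section \<open>Scalars and Hilbert spaces over the reals or the complex numbers\<close>

text \<open>
  The class covers the two scalar fields simultaneously.  By the theorem of Gelfand and Mazur a
  commutative real normed division algebra with multiplicative norm is the real line or the complex
  plane, and the last axiom forces \<open>scnj\<close> to be the identity or the complex conjugation.
\<close>

class rc_scalar = real_normed_field +
  fixes scnj :: "'a \<Rightarrow> 'a"
  assumes scnj_add: "scnj (a + b) = scnj a + scnj b"
    and scnj_mult: "scnj (a * b) = scnj a * scnj b"
    and mult_scnj: "a * scnj a = (norm a)\<^sup>2 *\<^sub>R 1"

instantiation real :: rc_scalar
begin

definition scnj_real :: "real \<Rightarrow> real" where
  "scnj_real a = a"

instance
  by standard (simp_all add: scnj_real_def power2_eq_square)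

end

instantiation complex :: rc_scalar
begin

definition scnj_complex :: "complex \<Rightarrow> complex" where
  "scnj_complex a = cnj a"

instance
  by standard (simp_all add: scnj_complex_def complex_norm_square[symmetric] scaleR_conv_of_real)

end

text \<open>
  A Hilbert space over the scalar field is a complete space whose norm comes from a scalar-valued
  inner product, linear in the first argument.  Norm and topology are those of the underlying real
  Hilbert space (a complex Hilbert space is a real one under the real part of its inner product).
\<close>

locale hilbert_space = vector_space scale
  for scale :: "'k::rc_scalar \<Rightarrow> 'x::{real_inner, complete_space} \<Rightarrow> 'x" +
  fixes ip :: "'x \<Rightarrow> 'x \<Rightarrow> 'k"
  assumes scale_of_real: "scale (of_real r) x = r *\<^sub>R x"
    and ip_add_left: "ip (x + y) z = ip x z + ip y z"
    and ip_scale_left: "ip (scale a x) y = a * ip x y"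
    and ip_commute: "ip y x = scnj (ip x y)"
    and ip_self: "ip x x = of_real ((norm x)\<^sup>2)"

lemma hilbert_space_real:
  "hilbert_space (scaleR :: real \<Rightarrow> 'x::{real_inner, complete_space} \<Rightarrow> 'x) inner"
  by unfold_locales
    (simp_all add: algebra_simps inner_add_left inner_commute scnj_real_def power2_norm_eq_inner)

lemma hilbert_space_complex: "hilbert_space ((*) :: complex \<Rightarrow> complex \<Rightarrow> complex) (\<lambda>x y. x * cnj y)"
  by unfold_locales
    (simp_all add: algebra_simps scnj_complex_def scaleR_conv_of_real complex_norm_square[symmetric])

definition orth_compl :: "('x::zero \<Rightarrow> 'x \<Rightarrow> 'k::zero) \<Rightarrow> 'x set \<Rightarrow> 'x set" where
  "orth_compl ip S = {x. \<forall>y\<in>S. ip x y = 0}"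

section \<open>Closed densely defined operators\<close>

text \<open>
  An unbounded operator is given by its domain \<open>D\<close> together with a total function \<open>K\<close> whose values
  outside \<open>D\<close> are irrelevant.
\<close>

definition closed_densely_defined_operator ::
    "('k \<Rightarrow> 'x \<Rightarrow> 'x) \<Rightarrow> ('k \<Rightarrow> 'y \<Rightarrow> 'y) \<Rightarrow>
     'x::real_normed_vector set \<Rightarrow> ('x \<Rightarrow> 'y::real_normed_vector) \<Rightarrow> bool" where
  "closed_densely_defined_operator sX sY D K \<longleftrightarrow>
     0 \<in> D \<and>
     (\<forall>x\<in>D. \<forall>y\<in>D. x + y \<in> D \<and> K (x + y) = K x + K y) \<and>
     (\<forall>a. \<forall>x\<in>D. sX a x \<in> D \<and> K (sX a x) = sY a (K x)) \<and>
     closure D = UNIV \<and>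
     closed {(x, K x) | x. x \<in> D}"

definition op_kernel :: "'x set \<Rightarrow> ('x \<Rightarrow> 'y::zero) \<Rightarrow> 'x set" where
  "op_kernel D K = {x\<in>D. K x = 0}"

definition adj_dom :: "('x \<Rightarrow> 'x \<Rightarrow> 'k) \<Rightarrow> ('y \<Rightarrow> 'y \<Rightarrow> 'k) \<Rightarrow> 'x set \<Rightarrow> ('x \<Rightarrow> 'y) \<Rightarrow> 'y set" where
  "adj_dom ipX ipY D K = {y. \<exists>z. \<forall>x\<in>D. ipY (K x) y = ipX x z}"

text \<open>For densely defined \<open>K\<close> and \<open>y \<in> adj_dom ipX ipY D K\<close>, the vector \<open>z\<close> below is unique.\<close>

definition adj :: "('x \<Rightarrow> 'x \<Rightarrow> 'k) \<Rightarrow> ('y \<Rightarrow> 'y \<Rightarrow> 'k) \<Rightarrow> 'x set \<Rightarrow> ('x \<Rightarrow> 'y) \<Rightarrow> 'y \<Rightarrow> 'x" where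
  "adj ipX ipY D K y = (THE z. \<forall>x\<in>D. ipY (K x) y = ipX x z)"

section \<open>Square-summable families and frames\<close>

definition l2 :: "'i set \<Rightarrow> ('i \<Rightarrow> 'k::real_normed_vector) set" where
  "l2 \<Lambda> = {\<omega>. (\<lambda>i. (norm (\<omega> i))\<^sup>2) summable_on \<Lambda>}"

definition l2_norm :: "'i set \<Rightarrow> ('i \<Rightarrow> 'k::real_normed_vector) \<Rightarrow> real" where
  "l2_norm \<Lambda> \<omega> = sqrt (\<Sum>\<^sub>\<infinity>i\<in>\<Lambda>. (norm (\<omega> i))\<^sup>2)"

text \<open>\<open>U\<close> is meant to be a closed subspace, regarded as a Hilbert space of its own.\<close>

definition is_frame ::
    "('x::real_normed_vector \<Rightarrow> 'x \<Rightarrow> 'k::real_normed_vector) \<Rightarrow> 'x set \<Rightarrow> 'i set \<Rightarrow> ('i \<Rightarrow> 'x) \<Rightarrow> bool" where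
  "is_frame ip U \<Lambda> u \<longleftrightarrow>
     (\<forall>i\<in>\<Lambda>. u i \<in> U) \<and>
     (\<exists>A>0. \<exists>B>0. \<forall>x\<in>U.
        (\<lambda>i. (norm (ip (u i) x))\<^sup>2) summable_on \<Lambda> \<and>
        A * (norm x)\<^sup>2 \<le> (\<Sum>\<^sub>\<infinity>i\<in>\<Lambda>. (norm (ip (u i) x))\<^sup>2) \<and>
        (\<Sum>\<^sub>\<infinity>i\<in>\<Lambda>. (norm (ip (u i) x))\<^sup>2) \<le> B * (norm x)\<^sup>2)"

definition is_dual_frame ::
    "('k::real_normed_vector \<Rightarrow> 'x \<Rightarrow> 'x) \<Rightarrow> ('x::real_normed_vector \<Rightarrow> 'x \<Rightarrow> 'k) \<Rightarrow> 'x set \<Rightarrow> 'i set \<Rightarrow>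
     ('i \<Rightarrow> 'x) \<Rightarrow> ('i \<Rightarrow> 'x) \<Rightarrow> bool" where
  "is_dual_frame sX ip U \<Lambda> u ubar \<longleftrightarrow>
     is_frame ip U \<Lambda> ubar \<and>
     (\<forall>x\<in>U. ((\<lambda>i. sX (ip x (u i)) (ubar i)) has_sum x) \<Lambda>)"

section \<open>Diagonal frame decompositions\<close>

definition is_dfd ::
    "('k::real_normed_field \<Rightarrow> 'x \<Rightarrow> 'x) \<Rightarrow> ('x \<Rightarrow> 'x \<Rightarrow> 'k) \<Rightarrow> ('y \<Rightarrow> 'y \<Rightarrow> 'k) \<Rightarrow>
     'x::real_normed_vector set \<Rightarrow> ('x \<Rightarrow> 'y::real_normed_vector) \<Rightarrow>
     'i set \<Rightarrow> ('i \<Rightarrow> 'x) \<Rightarrow> ('i \<Rightarrow> 'y) \<Rightarrow> ('i \<Rightarrow> real) \<Rightarrow> bool" where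
  "is_dfd sX ipX ipY D K \<Lambda> u v \<kappa> \<longleftrightarrow>
     is_frame ipX (orth_compl ipX (op_kernel D K)) \<Lambda> u \<and>
     is_frame ipY (closure (K ` D)) \<Lambda> v \<and>
     (\<forall>i\<in>\<Lambda>. \<kappa> i > 0) \<and>
     (\<forall>i\<in>\<Lambda>. v i \<in> adj_dom ipX ipY D K \<and> adj ipX ipY D K (v i) = sX (of_real (\<kappa> i)) (u i))"

definition filtered_dfd ::
    "('k::real_normed_field \<Rightarrow> 'x::real_normed_vector \<Rightarrow> 'x) \<Rightarrow> ('y \<Rightarrow> 'y \<Rightarrow> 'k) \<Rightarrow>
     'i set \<Rightarrow> ('i \<Rightarrow> 'x) \<Rightarrow> ('i \<Rightarrow> 'y) \<Rightarrow> ('i \<Rightarrow> real) \<Rightarrow> (real \<Rightarrow> real \<Rightarrow> real) \<Rightarrow> real \<Rightarrow> 'y \<Rightarrow> 'x" where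
  "filtered_dfd sX ipY \<Lambda> ubar v \<kappa> f \<alpha> y =
     (\<Sum>\<^sub>\<infinity>i\<in>\<Lambda>. sX (of_real (f \<alpha> (\<kappa> i)) * ipY y (v i)) (ubar i))"

section \<open>Regularizing filters and parameter choices\<close>

text \<open>
  Piecewise continuity on the open half-line: finitely many discontinuities in each compact
  subinterval, and finite one-sided limits everywhere.
\<close>

definition piecewise_continuous_pos :: "(real \<Rightarrow> real) \<Rightarrow> bool" where
  "piecewise_continuous_pos g \<longleftrightarrow>
     (\<forall>a>0. \<forall>b. finite {t\<in>{a..b}. \<not> isCont g t}) \<and>
     (\<forall>t>0. (\<exists>l. (g \<longlongrightarrow> l) (at_left t)) \<and> (\<exists>r. (g \<longlongrightarrow> r) (at_right t)))"

definition sup_norm_pos :: "(real \<Rightarrow> real) \<Rightarrow> real" where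
  "sup_norm_pos g = (SUP t\<in>{0<..}. \<bar>g t\<bar>)"

text \<open>Only the values \<open>f \<alpha> t\<close> with \<open>\<alpha> > 0\<close> and \<open>t > 0\<close> are relevant.\<close>

definition regularizing_filter :: "(real \<Rightarrow> real \<Rightarrow> real) \<Rightarrow> bool" where
  "regularizing_filter f \<longleftrightarrow>
     (\<forall>\<alpha>>0. piecewise_continuous_pos (f \<alpha>)) \<and>
     (\<forall>\<alpha>>0. bdd_above ((\<lambda>t. \<bar>f \<alpha> t\<bar>) ` {0<..})) \<and>
     (\<exists>C>0. \<forall>\<alpha>>0. \<forall>t>0. \<bar>t * f \<alpha> t\<bar> \<le> C) \<and>
     (\<forall>t>0. ((\<lambda>\<alpha>. f \<alpha> t) \<longlongrightarrow> 1 / t) (at_right 0))"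

definition parameter_choice_rate ::
    "real \<Rightarrow> real \<Rightarrow> real \<Rightarrow> real \<Rightarrow> (real \<Rightarrow> 'y \<Rightarrow> real) \<Rightarrow> bool" where
  "parameter_choice_rate c\<^sub>1 c\<^sub>2 \<mu> \<rho> \<alpha>s \<longleftrightarrow>
     (\<forall>\<delta>>0. \<forall>y. \<alpha>s \<delta> y > 0 \<and>
        c\<^sub>1 * (\<delta> / \<rho>) powr (2 / (2 * \<mu> + 1)) \<le> \<alpha>s \<delta> y \<and>
        \<alpha>s \<delta> y \<le> c\<^sub>2 * (\<delta> / \<rho>) powr (2 / (2 * \<mu> + 1)))"

definition source_condition ::
    "('x \<Rightarrow> 'x \<Rightarrow> 'k::real_normed_field) \<Rightarrow> 'i set \<Rightarrow> ('i \<Rightarrow> 'x) \<Rightarrow> ('i \<Rightarrow> real) \<Rightarrow>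
     real \<Rightarrow> real \<Rightarrow> 'x \<Rightarrow> bool" where
  "source_condition ipX \<Lambda> u \<kappa> \<mu> \<rho> x \<longleftrightarrow>
     (\<exists>\<omega>\<in>l2 \<Lambda>. l2_norm \<Lambda> \<omega> \<le> \<rho> \<and>
        (\<forall>i\<in>\<Lambda>. ipX x (u i) = of_real (\<kappa> i powr (2 * \<mu>)) * \<omega> i))"

end

theory Submission
  imports Defs
begin

text \<open>
  Write \<open>x\<close> for the exact solution and \<open>y\<close> for the noisy data.  Since \<open>K\<^sup>* v\<^sub>i = \<kappa>\<^sub>i u\<^sub>i\<close>, the exact data
  have the coefficients \<open>\<langle>K x, v\<^sub>i\<rangle> = \<kappa>\<^sub>i \<langle>x, u\<^sub>i\<rangle>\<close> (lemma \<open>dfd_coefficient\<close>), so the dual frame expansion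
  of \<open>x\<close> splits the error into two series in the dual frame,
  \<open>x - F\<^sub>\<alpha> y = (\<Sum>i. (1 - \<kappa>\<^sub>i f\<^sub>\<alpha>(\<kappa>\<^sub>i)) \<langle>x, u\<^sub>i\<rangle> ubar\<^sub>i) - (\<Sum>i. f\<^sub>\<alpha>(\<kappa>\<^sub>i) \<langle>y - K x, v\<^sub>i\<rangle> ubar\<^sub>i)\<close>,
  an approximation error and a propagated data error.  A series \<open>\<Sum>i. c\<^sub>i ubar\<^sub>i\<close> has norm at most a
  constant times the \<open>\<ell>\<^sup>2\<close> norm of \<open>c\<close>, so only coefficients have to be estimated: by the source
  condition and \<open>R2\<close> the first sequence has norm at most \<open>C\<^sub>\<mu> * \<alpha> powr \<mu> * \<rho>\<close>, and by \<open>R1\<close> the second,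
  for small \<open>\<alpha>\<close>, at most a constant times \<open>\<alpha> powr (-1/2) * \<delta>\<close> (lemma \<open>filtered_dfd_error\<close>).  The
  parameter choice makes both of the order \<open>\<delta> powr (2 * \<mu> / (2 * \<mu> + 1)) * \<rho> powr (1 / (2 * \<mu> + 1))\<close>
  (lemma \<open>parameter_balance\<close>).

  The data \<open>y\<close> may leave the closed range of \<open>K\<close>, on which the frame inequality of \<open>v\<close> is given.  All
  frame estimates are therefore derived from a bound for the synthesis operator: it follows from the
  upper frame inequality on the span of the frame alone (lemma \<open>frame_imp_bessel_bound\<close>), and it
  passes to the analysis operator on the whole space by duality (lemma \<open>bessel_bound_analysis\<close>).
\<close>

section \<open>Scalars and inner products\<close>

lemma scnj_0 [simp]: "scnj (0 :: 'k::rc_scalar) = 0"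
  using scnj_add[of "0::'k" 0] by simp

lemma scnj_of_real [simp]: "scnj (of_real r :: 'k::rc_scalar) = of_real r"
proof (cases "r = 0")
  case False
  have "of_real r * scnj (of_real r) = (of_real r * of_real r :: 'k)"
    by (simp add: mult_scnj power2_eq_square scaleR_conv_of_real)
  with False show ?thesis by simp
qed simp

lemma norm_scnj [simp]: "norm (scnj (a :: 'k::rc_scalar)) = norm a"
proof (cases "a = 0")
  case False
  have "norm a * norm (scnj a) = norm a * norm a"
    by (simp flip: norm_mult) (simp add: mult_scnj power2_eq_square norm_mult)
  with False show ?thesis by simp
qed simp

context hilbert_space
begin

lemma ip_zero_left [simp]: "ip 0 y = 0"
  using ip_add_left[of 0 0 y] by simp

lemma ip_minus_left: "ip (- x) y = - ip x y"
  using ip_add_left[of x "- x" y] by (simp add: eq_neg_iff_add_eq_0 add.commute)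

lemma ip_diff_left: "ip (x - y) z = ip x z - ip y z"
  using ip_add_left[of x "- y" z] by (simp add: ip_minus_left)

lemma ip_sum_left: "ip (\<Sum>i\<in>F. g i) y = (\<Sum>i\<in>F. ip (g i) y)"
  by (induction F rule: infinite_finite_induct) (simp_all add: ip_add_left)

lemma ip_scale_right: "ip x (scale a y) = scnj a * ip x y"
  by (metis ip_commute ip_scale_left scnj_mult)

lemma ip_add_right: "ip x (y + z) = ip x y + ip x z"
  by (metis ip_commute ip_add_left scnj_add)

lemma ip_diff_right: "ip x (y - z) = ip x y - ip x z"
  using ip_add_right[of x "y - z" z] by simp

lemma norm_ip_commute: "norm (ip x y) = norm (ip y x)"
  by (metis ip_commute norm_scnj)

lemma norm_scale: "norm (scale a x) = norm a * norm x"
proof -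
  have "of_real ((norm (scale a x))\<^sup>2) = (a * scnj a) * ip x x"
    by (simp add: ip_self[symmetric] ip_scale_left ip_scale_right mult.assoc del: of_real_power)
  also have "\<dots> = of_real ((norm a * norm x)\<^sup>2)"
    by (simp add: mult_scnj ip_self power_mult_distrib scaleR_conv_of_real)
  finally have "(norm (scale a x))\<^sup>2 = (norm a * norm x)\<^sup>2"
    using of_real_eq_iff by blast
  then show ?thesis by simp
qed

text \<open>
  The abstract scalar field carries no real part.  It is avoided by expanding
  \<open>ip (x - w) (x - w)\<close> only for \<open>w\<close> a real multiple of \<open>scale (ip x y) y\<close>, where the mixed terms are
  multiples of \<open>ip x y * scnj (ip x y)\<close> and hence real.
\<close>

lemma ip_Cauchy_Schwarz: "norm (ip x y) \<le> norm x * norm y"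
proof (cases "y = 0")
  case True
  then show ?thesis
    by (metis ip_zero_left norm_ip_commute norm_zero mult_zero_right order_refl)
next
  case False
  define p where "p = ip x y"
  \<comment> \<open>\<open>scale (of_real t * p) y\<close> is the projection of \<open>x\<close> onto the line of \<open>y\<close>.\<close>
  define t where "t = 1 / (norm y)\<^sup>2"
  have pp: "p * scnj p = of_real ((norm p)\<^sup>2)"
    by (simp add: mult_scnj scaleR_conv_of_real)
  have yx: "ip y x = scnj p"
    unfolding p_def by (rule ip_commute)
  have "ip (x - scale (of_real t * p) y) (x - scale (of_real t * p) y)
      = ip x x - of_real t * (p * scnj p) - of_real t * (p * scnj p)
        + of_real t * of_real t * (p * scnj p) * ip y y"
    unfolding ip_diff_left ip_diff_right ip_scale_left ip_scale_right yx p_def[symmetric]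
    by (simp add: scnj_mult right_diff_distrib mult_ac)
  also have "\<dots> = of_real ((norm x)\<^sup>2 - 2 * t * (norm p)\<^sup>2 + t\<^sup>2 * (norm p)\<^sup>2 * (norm y)\<^sup>2)"
    by (simp add: pp ip_self power2_eq_square algebra_simps)
  finally have "(norm (x - scale (of_real t * p) y))\<^sup>2
      = (norm x)\<^sup>2 - 2 * t * (norm p)\<^sup>2 + t\<^sup>2 * (norm p)\<^sup>2 * (norm y)\<^sup>2"
    unfolding ip_self using of_real_eq_iff by blast
  also have "\<dots> = (norm x)\<^sup>2 - (norm p)\<^sup>2 / (norm y)\<^sup>2"
    using False by (simp add: t_def power2_eq_square divide_simps)
  finally have "(norm p)\<^sup>2 / (norm y)\<^sup>2 \<le> (norm x)\<^sup>2"
    by (metis zero_le_power2 diff_ge_0_iff_ge)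
  then have "(norm p)\<^sup>2 \<le> (norm x * norm y)\<^sup>2"
    using False by (simp add: divide_simps power_mult_distrib)
  then show ?thesis
    unfolding p_def by (rule power2_le_imp_le) simp
qed

end

section \<open>Summability and square-summable families\<close>

text \<open>
  The Cauchy criterion for the net of finite partial sums.  Completeness of the space suffices and no
  absolute convergence is involved, which fails in general for frame expansions.
\<close>

lemma summable_on_if_small_tails:
  fixes g :: "'i \<Rightarrow> 'a::{real_normed_vector, complete_space}"
  assumes tails: "\<And>e. e > 0 \<Longrightarrow> \<exists>F0. finite F0 \<and> F0 \<subseteq> A \<and>
    (\<forall>F. finite F \<longrightarrow> F \<subseteq> A - F0 \<longrightarrow> norm (sum g F) \<le> e)"
  shows "g summable_on A"
proof -
  have "\<exists>P. eventually P (finite_subsets_at_top A) \<and>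
      (\<forall>F F'. P F \<and> P F' \<longrightarrow> dist (sum g F) (sum g F') < e)" if "e > 0" for e
  proof -
    obtain F0 where F0: "finite F0" "F0 \<subseteq> A"
      and small: "\<And>F. finite F \<Longrightarrow> F \<subseteq> A - F0 \<Longrightarrow> norm (sum g F) \<le> e / 3"
      using tails[of "e / 3"] \<open>e > 0\<close> by auto
    define P where "P F \<longleftrightarrow> finite F \<and> F0 \<subseteq> F \<and> F \<subseteq> A" for F
    have "eventually P (finite_subsets_at_top A)"
      unfolding eventually_finite_subsets_at_top P_def using F0 by blast
    moreover have "dist (sum g F) (sum g F') < e" if "P F" "P F'" for F F'
    proof -
      have split: "sum g G = sum g (G - F0) + sum g F0" "norm (sum g (G - F0)) \<le> e / 3" if "P G" for G
        using that sum.subset_diff[of F0 G g] small[of "G - F0"] by (auto simp: P_def)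
      have "dist (sum g F) (sum g F') = norm (sum g (F - F0) - sum g (F' - F0))"
        using split(1)[OF \<open>P F\<close>] split(1)[OF \<open>P F'\<close>] by (simp add: dist_norm)
      also have "\<dots> \<le> e / 3 + e / 3"
        using split(2)[OF \<open>P F\<close>] split(2)[OF \<open>P F'\<close>] by norm
      also have "\<dots> < e"
        using \<open>e > 0\<close> by simp
      finally show ?thesis .
    qed
    ultimately show ?thesis by blast
  qed
  then have "cauchy_filter (filtermap (sum g) (finite_subsets_at_top A))"
    by (simp add: cauchy_filter_metric_filtermap)
  then obtain L where "(sum g \<longlongrightarrow> L) (finite_subsets_at_top A)"
    using complete_uniform[where S = "UNIV :: 'a set"] complete_UNIV by (force simp: filterlim_def)
  then show ?thesis
    using summable_on_def has_sum_def by blast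
qed

lemma l2_dominated:
  assumes c: "c \<in> l2 \<Lambda>" and le: "\<And>i. i \<in> \<Lambda> \<Longrightarrow> norm (a i) \<le> m * norm (c i)" and m: "m \<ge> 0"
  shows "a \<in> l2 \<Lambda>" and "l2_norm \<Lambda> a \<le> m * l2_norm \<Lambda> c"
proof -
  have le2: "(norm (a i))\<^sup>2 \<le> m\<^sup>2 * (norm (c i))\<^sup>2" if "i \<in> \<Lambda>" for i
    using power_mono[OF le[OF that], of 2] by (simp add: power_mult_distrib)
  have sm: "(\<lambda>i. m\<^sup>2 * (norm (c i))\<^sup>2) summable_on \<Lambda>"
    using c by (auto simp: l2_def intro: summable_on_cmult_right)
  have sa: "(\<lambda>i. (norm (a i))\<^sup>2) summable_on \<Lambda>"
    by (rule summable_on_comparison_test[OF sm le2]) auto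
  then show "a \<in> l2 \<Lambda>"
    by (simp add: l2_def)
  have "(\<Sum>\<^sub>\<infinity>i\<in>\<Lambda>. (norm (a i))\<^sup>2) \<le> m\<^sup>2 * (\<Sum>\<^sub>\<infinity>i\<in>\<Lambda>. (norm (c i))\<^sup>2)"
    using infsum_mono[OF sa sm le2] by (simp add: infsum_cmult_right')
  then show "l2_norm \<Lambda> a \<le> m * l2_norm \<Lambda> c"
    unfolding l2_norm_def using m
    by (metis real_sqrt_le_mono real_sqrt_mult real_sqrt_abs abs_of_nonneg)
qed

section \<open>Bessel bounds\<close>

context hilbert_space
begin

text \<open>
  A bound for the norm of the synthesis operator \<open>c \<mapsto> \<Sum>i. c\<^sub>i u\<^sub>i\<close> on \<open>\<ell>\<^sup>2\<close>, the square root of the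
  customary Bessel constant.  It is stated for finite sums, so that convergence of the infinite ones
  can be deduced from it.
\<close>

definition bessel_bound :: "real \<Rightarrow> 'i set \<Rightarrow> ('i \<Rightarrow> 'x) \<Rightarrow> bool" where
  "bessel_bound B \<Lambda> u \<longleftrightarrow> B \<ge> 0 \<and>
     (\<forall>F c. finite F \<longrightarrow> F \<subseteq> \<Lambda> \<longrightarrow>
        norm (\<Sum>i\<in>F. scale (c i) (u i)) \<le> B * L2_set (\<lambda>i. norm (c i)) F)"

text \<open>
  A finite combination \<open>z\<close> of the frame lies in \<open>U\<close>, so the frame inequality applies to \<open>z\<close> itself:
  \<open>\<parallel>z\<parallel>\<^sup>2 = \<Sum>i. c\<^sub>i \<langle>u\<^sub>i, z\<rangle>\<close> is at most \<open>\<parallel>c\<parallel> \<surd>B \<parallel>z\<parallel>\<close>, and one factor \<open>\<parallel>z\<parallel>\<close> cancels.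
\<close>

lemma frame_imp_bessel_bound:
  assumes U: "subspace U" and fr: "is_frame ip U \<Lambda> u"
  obtains B where "bessel_bound B \<Lambda> u"
proof -
  from fr obtain B where uU: "\<And>i. i \<in> \<Lambda> \<Longrightarrow> u i \<in> U" and B: "B > 0"
    and sm: "\<And>x. x \<in> U \<Longrightarrow> (\<lambda>i. (norm (ip (u i) x))\<^sup>2) summable_on \<Lambda>"
    and le: "\<And>x. x \<in> U \<Longrightarrow> (\<Sum>\<^sub>\<infinity>i\<in>\<Lambda>. (norm (ip (u i) x))\<^sup>2) \<le> B * (norm x)\<^sup>2"
    unfolding is_frame_def by blast
  have "norm (\<Sum>i\<in>F. scale (c i) (u i)) \<le> sqrt B * L2_set (\<lambda>i. norm (c i)) F"
    if F: "finite F" "F \<subseteq> \<Lambda>" for F c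
  proof -
    define z where "z = (\<Sum>i\<in>F. scale (c i) (u i))"
    have zU: "z \<in> U"
      unfolding z_def using F uU U by (intro subspace_sum subspace_scale) auto
    have "(\<Sum>i\<in>F. (norm (ip (u i) z))\<^sup>2) \<le> B * (norm z)\<^sup>2"
      using finite_sum_le_infsum[OF sm[OF zU] F] le[OF zU] by fastforce
    then have L: "L2_set (\<lambda>i. norm (ip (u i) z)) F \<le> sqrt B * norm z"
      unfolding L2_set_def using real_sqrt_le_mono by (fastforce simp: real_sqrt_mult)
    have "(norm z)\<^sup>2 = norm (ip z z)"
      by (simp add: ip_self norm_power)
    also have "\<dots> = norm (\<Sum>i\<in>F. c i * ip (u i) z)"
      by (subst (1) z_def) (simp add: ip_sum_left ip_scale_left)
    also have "\<dots> \<le> (\<Sum>i\<in>F. \<bar>norm (c i)\<bar> * \<bar>norm (ip (u i) z)\<bar>)"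
      by (rule order_trans[OF norm_sum]) (simp add: norm_mult)
    also have "\<dots> \<le> L2_set (\<lambda>i. norm (c i)) F * L2_set (\<lambda>i. norm (ip (u i) z)) F"
      by (rule L2_set_mult_ineq)
    also have "\<dots> \<le> L2_set (\<lambda>i. norm (c i)) F * (sqrt B * norm z)"
      by (intro mult_left_mono L L2_set_nonneg)
    finally have "norm z * norm z \<le> (sqrt B * L2_set (\<lambda>i. norm (c i)) F) * norm z"
      by (simp add: power2_eq_square mult_ac)
    then show ?thesis
      unfolding z_def[symmetric] using B L2_set_nonneg[of "\<lambda>i. norm (c i)" F]
      by (cases "z = 0") auto
  qed
  then show ?thesis
    using B by (intro that[of "sqrt B"]) (auto simp: bessel_bound_def)
qed

text \<open>
  The analysis operator is the adjoint of the synthesis operator, so it has the same bound on the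
  whole space.  A frame of a closed subspace thus obeys its upper frame inequality also for vectors
  outside the subspace, which is what makes it applicable to arbitrary noisy data.
\<close>

lemma bessel_bound_analysis:
  assumes B: "bessel_bound B \<Lambda> u" and F: "finite F" "F \<subseteq> \<Lambda>"
  shows "L2_set (\<lambda>i. norm (ip y (u i))) F \<le> B * norm y"
proof -
  define L where "L = L2_set (\<lambda>i. norm (ip y (u i))) F"
  define z where "z = (\<Sum>i\<in>F. scale (ip y (u i)) (u i))"
  have "ip z y = (\<Sum>i\<in>F. ip y (u i) * scnj (ip y (u i)))"
    by (simp add: z_def ip_sum_left ip_scale_left flip: ip_commute)
  also have "\<dots> = of_real (\<Sum>i\<in>F. (norm (ip y (u i)))\<^sup>2)"
    by (simp add: mult_scnj scaleR_conv_of_real)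
  also have "\<dots> = of_real (L\<^sup>2)"
    by (simp add: L_def L2_set_def sum_nonneg)
  finally have "L * L = norm (ip z y)"
    by (simp add: norm_power power2_eq_square norm_mult)
  also have "\<dots> \<le> norm z * norm y"
    by (rule ip_Cauchy_Schwarz)
  also have "\<dots> \<le> (B * L) * norm y"
    using B F unfolding bessel_bound_def z_def L_def by (intro mult_right_mono) auto
  finally have "L * L \<le> (B * norm y) * L"
    by (simp add: mult_ac)
  moreover have "L \<ge> 0" "B * norm y \<ge> 0"
    using B by (auto simp: L_def bessel_bound_def)
  ultimately show ?thesis
    unfolding L_def[symmetric] by (cases "L = 0") auto
qed

lemma bessel_bound_analysis_l2:
  assumes B: "bessel_bound B \<Lambda> u"
  shows "(\<lambda>i. ip y (u i)) \<in> l2 \<Lambda>" and "l2_norm \<Lambda> (\<lambda>i. ip y (u i)) \<le> B * norm y"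
proof -
  have fin: "(\<Sum>i\<in>F. (norm (ip y (u i)))\<^sup>2) \<le> (B * norm y)\<^sup>2" if "finite F" "F \<subseteq> \<Lambda>" for F
    using bessel_bound_analysis[OF B that, of y] unfolding L2_set_def by (rule sqrt_le_D)
  show "(\<lambda>i. ip y (u i)) \<in> l2 \<Lambda>"
    unfolding l2_def mem_Collect_eq using fin
    by (intro nonneg_bdd_above_summable_on bdd_aboveI2[of _ _ "(B * norm y)\<^sup>2"]) auto
  then have "(\<Sum>\<^sub>\<infinity>i\<in>\<Lambda>. (norm (ip y (u i)))\<^sup>2) \<le> (B * norm y)\<^sup>2"
    unfolding l2_def by (intro infsum_le_finite_sums fin) auto
  then have "l2_norm \<Lambda> (\<lambda>i. ip y (u i)) \<le> sqrt ((B * norm y)\<^sup>2)"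
    unfolding l2_norm_def by (rule real_sqrt_le_mono)
  also have "\<dots> = B * norm y"
    using B by (simp add: bessel_bound_def)
  finally show "l2_norm \<Lambda> (\<lambda>i. ip y (u i)) \<le> B * norm y" .
qed

text \<open>
  The tails of the series are controlled by the tails of the convergent series of \<open>\<bar>c\<^sub>i\<bar>\<^sup>2\<close>.
\<close>

lemma bessel_bound_synthesis_summable:
  assumes B: "bessel_bound B \<Lambda> u" and c: "c \<in> l2 \<Lambda>"
  shows "(\<lambda>i. scale (c i) (u i)) summable_on \<Lambda>"
proof (rule summable_on_if_small_tails)
  fix e :: real assume "e > 0"
  have B0: "B \<ge> 0"
    using B by (simp add: bessel_bound_def)
  \<comment> \<open>The summand \<open>1\<close> covers \<open>B = 0\<close>.\<close>
  define d where "d = e / (B + 1)"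
  have d: "d > 0" "B * d \<le> e"
    using \<open>e > 0\<close> B0 by (auto simp: d_def field_simps)
  have sm: "(\<lambda>i. (norm (c i))\<^sup>2) summable_on \<Lambda>"
    using c by (simp add: l2_def)
  from infsum_finite_approximation[OF sm, of "d\<^sup>2"] d obtain F0 where F0: "finite F0" "F0 \<subseteq> \<Lambda>"
    and close: "dist (\<Sum>i\<in>F0. (norm (c i))\<^sup>2) (\<Sum>\<^sub>\<infinity>i\<in>\<Lambda>. (norm (c i))\<^sup>2) \<le> d\<^sup>2"
    by auto
  have "norm (\<Sum>i\<in>F. scale (c i) (u i)) \<le> e" if F: "finite F" "F \<subseteq> \<Lambda> - F0" for F
  proof -
    have "(\<Sum>i\<in>F. (norm (c i))\<^sup>2) + (\<Sum>i\<in>F0. (norm (c i))\<^sup>2) = (\<Sum>i\<in>F \<union> F0. (norm (c i))\<^sup>2)"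
      using F F0 by (intro sum.union_disjoint[symmetric]) auto
    also have "\<dots> \<le> (\<Sum>\<^sub>\<infinity>i\<in>\<Lambda>. (norm (c i))\<^sup>2)"
      using F F0 by (intro finite_sum_le_infsum sm) auto
    finally have "(\<Sum>i\<in>F. (norm (c i))\<^sup>2) \<le> d\<^sup>2"
      using close by (simp add: dist_real_def)
    then have "L2_set (\<lambda>i. norm (c i)) F \<le> d"
      unfolding L2_set_def using d by (intro real_le_lsqrt) (auto intro: sum_nonneg)
    then have "B * L2_set (\<lambda>i. norm (c i)) F \<le> B * d"
      using B0 by (rule mult_left_mono)
    moreover have "norm (\<Sum>i\<in>F. scale (c i) (u i)) \<le> B * L2_set (\<lambda>i. norm (c i)) F"
      using B F unfolding bessel_bound_def by auto
    ultimately show ?thesis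
      using d(2) by linarith
  qed
  with F0 show "\<exists>F0. finite F0 \<and> F0 \<subseteq> \<Lambda> \<and>
      (\<forall>F. finite F \<longrightarrow> F \<subseteq> \<Lambda> - F0 \<longrightarrow> norm (\<Sum>i\<in>F. scale (c i) (u i)) \<le> e)"
    by blast
qed

lemma bessel_bound_synthesis_norm:
  assumes B: "bessel_bound B \<Lambda> u" and c: "c \<in> l2 \<Lambda>"
    and s: "((\<lambda>i. scale (c i) (u i)) has_sum s) \<Lambda>"
  shows "norm s \<le> B * l2_norm \<Lambda> c"
proof -
  have "norm (\<Sum>i\<in>F. scale (c i) (u i)) \<le> B * l2_norm \<Lambda> c" if F: "finite F" "F \<subseteq> \<Lambda>" for F
  proof -
    have "L2_set (\<lambda>i. norm (c i)) F \<le> l2_norm \<Lambda> c"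
      unfolding L2_set_def l2_norm_def using c F
      by (intro real_sqrt_le_mono finite_sum_le_infsum) (auto simp: l2_def)
    with B F show ?thesis
      unfolding bessel_bound_def by (meson mult_left_mono order_trans)
  qed
  then have "\<forall>\<^sub>F F in finite_subsets_at_top \<Lambda>. norm (\<Sum>i\<in>F. scale (c i) (u i)) \<le> B * l2_norm \<Lambda> c"
    by (intro eventually_finite_subsets_at_top_weakI) auto
  then show ?thesis
    using s unfolding has_sum_def
    by (intro tendsto_upperbound[OF tendsto_norm]) auto
qed

end

section \<open>Subspaces, adjoints and the singular relation\<close>

context hilbert_space
begin

lemma subspace_orth_compl: "subspace (orth_compl ip S)"
  by (auto simp: subspace_def orth_compl_def ip_add_left ip_scale_left)

lemma tendsto_scale: "(g \<longlongrightarrow> l) F \<Longrightarrow> ((\<lambda>n. scale a (g n)) \<longlongrightarrow> scale a l) F"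
proof -
  assume "(g \<longlongrightarrow> l) F"
  then have "((\<lambda>n. norm a * norm (g n - l)) \<longlongrightarrow> norm a * 0) F"
    by (intro tendsto_mult tendsto_const tendsto_norm_zero LIM_zero)
  then have "((\<lambda>n. norm (scale a (g n) - scale a l)) \<longlongrightarrow> 0) F"
    by (simp add: norm_scale flip: scale_right_diff_distrib)
  then show ?thesis
    using LIM_zero_cancel tendsto_norm_zero_iff by blast
qed

lemma subspace_closure_scale:
  assumes "subspace S"
  shows "subspace (closure S)"
proof (rule subspaceI)
  show "0 \<in> closure S"
    using subspace_0[OF assms] closure_subset by blast
next
  fix x y assume "x \<in> closure S" "y \<in> closure S"
  then obtain xs ys where "\<And>n. xs n \<in> S" "xs \<longlonglongrightarrow> x" "\<And>n. ys n \<in> S" "ys \<longlonglongrightarrow> y"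
    unfolding closure_sequential by blast
  then have "\<forall>n. xs n + ys n \<in> S" "(\<lambda>n. xs n + ys n) \<longlonglongrightarrow> x + y"
    by (auto intro: tendsto_add subspace_add[OF assms])
  then show "x + y \<in> closure S"
    unfolding closure_sequential by (intro exI conjI)
next
  fix a x assume "x \<in> closure S"
  then obtain xs where "\<And>n. xs n \<in> S" "xs \<longlonglongrightarrow> x"
    unfolding closure_sequential by blast
  then have "\<forall>n. scale a (xs n) \<in> S" "(\<lambda>n. scale a (xs n)) \<longlonglongrightarrow> scale a x"
    by (auto intro: tendsto_scale subspace_scale[OF assms])
  then show "scale a x \<in> closure S"
    unfolding closure_sequential by (intro exI conjI)
qed

text \<open>
  Approximate \<open>w\<close> by \<open>xs n\<close> in \<open>D\<close>: then \<open>\<parallel>w\<parallel>\<^sup>2 = \<langle>w - xs n, w\<rangle>\<close> is bounded by a null sequence.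
\<close>

lemma eq_0_if_orthogonal_to_dense:
  assumes "closure D = UNIV" and orth: "\<And>x. x \<in> D \<Longrightarrow> ip x w = 0"
  shows "w = 0"
proof -
  obtain xs where xs: "\<And>n. xs n \<in> D" "xs \<longlonglongrightarrow> w"
    using assms(1) by (metis UNIV_I closure_sequential)
  have "norm w * norm w \<le> norm (w - xs n) * norm w" for n
  proof -
    have "norm w * norm w = norm (ip (w - xs n) w)"
      using orth[OF xs(1)] by (simp add: ip_diff_left ip_self norm_power norm_mult power2_eq_square)
    then show ?thesis
      using ip_Cauchy_Schwarz by metis
  qed
  moreover have "(\<lambda>n. norm (w - xs n) * norm w) \<longlonglongrightarrow> norm (w - w) * norm w"
    by (intro tendsto_intros xs(2))
  ultimately have "norm w * norm w \<le> norm (w - w) * norm w"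
    by (intro LIMSEQ_le_const) auto
  then show ?thesis
    by (simp add: mult_le_0_iff)
qed

text \<open>
  The description of \<open>adj\<close> by \<open>THE\<close> is meaningful because a vector orthogonal to the dense domain
  vanishes.
\<close>

lemma ip_adj:
  assumes dense: "closure D = UNIV" and y: "y \<in> adj_dom ip ipY D K" and x: "x \<in> D"
  shows "ipY (K x) y = ip x (adj ip ipY D K y)"
proof -
  obtain z where z: "\<forall>x\<in>D. ipY (K x) y = ip x z"
    using y by (auto simp: adj_dom_def)
  have "adj ip ipY D K y = z"
    unfolding adj_def
  proof (rule the_equality)
    fix z' assume "\<forall>x\<in>D. ipY (K x) y = ip x z'"
    with z have "z' - z = 0"
      by (intro eq_0_if_orthogonal_to_dense[OF dense]) (simp add: ip_diff_right)
    then show "z' = z" by simp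
  qed (fact z)
  with z x show ?thesis by simp
qed

end

lemma closed_densely_defined_operator_subspace_range:
  assumes "vector_space sX" and Y: "vector_space sY" and K: "closed_densely_defined_operator sX sY D K"
  shows "module.subspace sY (K ` D)"
proof -
  interpret vector_space sX by fact
  interpret Y: vector_space sY by fact
  have add: "x + y \<in> D" "K (x + y) = K x + K y" if "x \<in> D" "y \<in> D" for x y
    using K that by (auto simp: closed_densely_defined_operator_def)
  have scale: "sX a x \<in> D" "K (sX a x) = sY a (K x)" if "x \<in> D" for a x
    using K that by (auto simp: closed_densely_defined_operator_def)
  have "0 \<in> D"
    using K by (simp add: closed_densely_defined_operator_def)
  show ?thesis
  proof (rule Y.subspaceI)
    show "0 \<in> K ` D"
      using scale(2)[OF \<open>0 \<in> D\<close>, of 0] \<open>0 \<in> D\<close> by (intro image_eqI[of 0 K 0]) auto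
    show "x + y \<in> K ` D" if "x \<in> K ` D" "y \<in> K ` D" for x y
      using that by (elim imageE) (simp add: add(1) flip: add(2))
    show "sY a x \<in> K ` D" if "x \<in> K ` D" for a x
      using that by (elim imageE) (simp add: scale(1) flip: scale(2))
  qed
qed

text \<open>
  The operator acts diagonally on frame coefficients because \<open>K\<^sup>*\<close> maps \<open>v\<^sub>i\<close> to \<open>\<kappa>\<^sub>i u\<^sub>i\<close>; the factor
  survives the semilinearity of \<open>ipX\<close> in its second argument since it is real.
\<close>

lemma dfd_coefficient:
  assumes "hilbert_space sX ipX" and "closure D = UNIV"
    and dfd: "is_dfd sX ipX ipY D K \<Lambda> u v \<kappa>" and "x \<in> D" and "i \<in> \<Lambda>"
  shows "ipY (K x) (v i) = of_real (\<kappa> i) * ipX x (u i)"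
proof -
  interpret hilbert_space sX ipX by fact
  have "v i \<in> adj_dom ipX ipY D K" "adj ipX ipY D K (v i) = sX (of_real (\<kappa> i)) (u i)"
    using dfd \<open>i \<in> \<Lambda>\<close> by (auto simp: is_dfd_def)
  with ip_adj[OF assms(2) _ \<open>x \<in> D\<close>, of "v i" ipY K] show ?thesis
    by (simp add: ip_scale_right)
qed

section \<open>The error of a filtered frame decomposition\<close>

text \<open>
  A deterministic estimate at a fixed regularization parameter.  The sequence \<open>a\<close> in the proof carries
  the approximation error, where \<open>q\<close> bounds the filter residual against the smoothness weight; the
  sequence \<open>b\<close> carries the data error, amplified at most by \<open>M\<close>.  The series defining the filtered
  decomposition converges because it is the dual frame expansion of \<open>x\<close> corrected by the two
  square-summable perturbations.
\<close>

lemma filtered_dfd_error: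
  assumes X: "hilbert_space sX ipX" and Y: "hilbert_space sY ipY"
    and Bu: "hilbert_space.bessel_bound sX Bu \<Lambda> ubar"
    and Bv: "hilbert_space.bessel_bound sY Bv \<Lambda> v"
    and dual: "((\<lambda>i. sX (ipX x (u i)) (ubar i)) has_sum x) \<Lambda>"
    and coeff: "\<And>i. i \<in> \<Lambda> \<Longrightarrow> ipY y0 (v i) = of_real (\<kappa> i) * ipX x (u i)"
    and source: "source_condition ipX \<Lambda> u \<kappa> \<mu> \<rho> x"
    and q: "\<And>i. i \<in> \<Lambda> \<Longrightarrow> \<kappa> i powr (2 * \<mu>) * \<bar>1 - \<kappa> i * f \<alpha> (\<kappa> i)\<bar> \<le> q" and "q \<ge> 0"
    and M: "\<And>i. i \<in> \<Lambda> \<Longrightarrow> \<bar>f \<alpha> (\<kappa> i)\<bar> \<le> M" and "M \<ge> 0"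
  shows "norm (x - filtered_dfd sX ipY \<Lambda> ubar v \<kappa> f \<alpha> y) \<le> Bu * (q * \<rho> + M * (Bv * norm (y - y0)))"
proof -
  interpret X: hilbert_space sX ipX by fact
  interpret Y: hilbert_space sY ipY by fact
  obtain \<omega> where \<omega>: "\<omega> \<in> l2 \<Lambda>" "l2_norm \<Lambda> \<omega> \<le> \<rho>"
    and src: "\<And>i. i \<in> \<Lambda> \<Longrightarrow> ipX x (u i) = of_real (\<kappa> i powr (2 * \<mu>)) * \<omega> i"
    using source unfolding source_condition_def by blast
  have Bu0: "Bu \<ge> 0"
    using Bu by (simp add: X.bessel_bound_def)
  define a where "a = (\<lambda>i. of_real (1 - \<kappa> i * f \<alpha> (\<kappa> i)) * ipX x (u i))"
  define b where "b = (\<lambda>i. of_real (f \<alpha> (\<kappa> i)) * ipY (y - y0) (v i))"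
  have "norm (a i) \<le> q * norm (\<omega> i)" if "i \<in> \<Lambda>" for i
  proof -
    have "norm (a i) = (\<kappa> i powr (2 * \<mu>) * \<bar>1 - \<kappa> i * f \<alpha> (\<kappa> i)\<bar>) * norm (\<omega> i)"
      unfolding a_def src[OF that] norm_mult norm_of_real by (simp add: mult_ac)
    then show ?thesis
      using q[OF that] by (simp add: mult_right_mono)
  qed
  note a = l2_dominated[OF \<omega>(1) this \<open>q \<ge> 0\<close>]
  have "norm (b i) \<le> M * norm (ipY (y - y0) (v i))" if "i \<in> \<Lambda>" for i
    using M[OF that] by (simp add: b_def norm_mult mult_right_mono)
  note b = l2_dominated[OF Y.bessel_bound_analysis_l2(1)[OF Bv] this \<open>M \<ge> 0\<close>]
  obtain sa where sa: "((\<lambda>i. sX (a i) (ubar i)) has_sum sa) \<Lambda>"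
    using X.bessel_bound_synthesis_summable[OF Bu a(1)] by (auto simp: summable_on_def)
  obtain sb where sb: "((\<lambda>i. sX (b i) (ubar i)) has_sum sb) \<Lambda>"
    using X.bessel_bound_synthesis_summable[OF Bu b(1)] by (auto simp: summable_on_def)
  have na: "norm sa \<le> Bu * (q * \<rho>)"
  proof -
    have "norm sa \<le> Bu * l2_norm \<Lambda> a"
      by (rule X.bessel_bound_synthesis_norm[OF Bu a(1) sa])
    also have "\<dots> \<le> Bu * (q * \<rho>)"
      using a(2) mult_left_mono[OF \<omega>(2) \<open>q \<ge> 0\<close>] Bu0 by (intro mult_left_mono) auto
    finally show ?thesis .
  qed
  have nb: "norm sb \<le> Bu * (M * (Bv * norm (y - y0)))"
  proof -
    have "norm sb \<le> Bu * l2_norm \<Lambda> b"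
      by (rule X.bessel_bound_synthesis_norm[OF Bu b(1) sb])
    also have "\<dots> \<le> Bu * (M * (Bv * norm (y - y0)))"
      using b(2) mult_left_mono[OF Y.bessel_bound_analysis_l2(2)[OF Bv, of "y - y0"] \<open>M \<ge> 0\<close>] Bu0
      by (intro mult_left_mono) auto
    finally show ?thesis .
  qed
  have "((\<lambda>i. sX (ipX x (u i)) (ubar i) + (- sX (a i) (ubar i)) + sX (b i) (ubar i))
      has_sum (x + (- sa) + sb)) \<Lambda>"
    using sa by (intro has_sum_add dual sb) (simp add: has_sum_uminus)
  also have "?this \<longleftrightarrow>
      ((\<lambda>i. sX (of_real (f \<alpha> (\<kappa> i)) * ipY y (v i)) (ubar i)) has_sum (x + (- sa) + sb)) \<Lambda>"
  proof (rule has_sum_cong)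
    fix i assume "i \<in> \<Lambda>"
    have "ipX x (u i) - a i + b i = of_real (f \<alpha> (\<kappa> i)) * ipY y (v i)"
      unfolding a_def b_def Y.ip_diff_left coeff[OF \<open>i \<in> \<Lambda>\<close>] by (simp add: algebra_simps)
    then show "sX (ipX x (u i)) (ubar i) + - sX (a i) (ubar i) + sX (b i) (ubar i)
        = sX (of_real (f \<alpha> (\<kappa> i)) * ipY y (v i)) (ubar i)"
      by (metis X.scale_left_diff_distrib X.scale_left_distrib add_uminus_conv_diff)
  qed
  finally have "filtered_dfd sX ipY \<Lambda> ubar v \<kappa> f \<alpha> y = x - sa + sb"
    unfolding filtered_dfd_def by (simp add: infsumI)
  then have "norm (x - filtered_dfd sX ipY \<Lambda> ubar v \<kappa> f \<alpha> y) \<le> norm sa + norm sb"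
    using norm_triangle_ineq4[of sa sb] by simp
  with na nb show ?thesis
    by (simp add: distrib_left)
qed

section \<open>Balancing approximation and data error\<close>

text \<open>
  The parameter \<open>\<alpha>\<close> is of the order of \<open>r = (\<delta> / \<rho>) powr (2 * s)\<close> with \<open>s = 1 / (2 * \<mu> + 1)\<close>, for which
  \<open>r powr \<mu> * \<rho>\<close> and \<open>r powr (-1/2) * \<delta>\<close> both equal \<open>\<delta> powr (1 - s) * \<rho> powr s\<close>.  The growing term needs the upper bound on \<open>\<alpha>\<close> and the decaying term the
  lower one.
\<close>

lemma parameter_balance:
  fixes \<mu> \<rho> \<delta> \<alpha> c\<^sub>1 c\<^sub>2 :: real
  assumes "\<mu> > 0" "\<rho> > 0" "\<delta> > 0" "c\<^sub>1 > 0" "c\<^sub>2 > 0"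
    and lower: "c\<^sub>1 * (\<delta> / \<rho>) powr (2 / (2 * \<mu> + 1)) \<le> \<alpha>"
    and upper: "\<alpha> \<le> c\<^sub>2 * (\<delta> / \<rho>) powr (2 / (2 * \<mu> + 1))"
  shows "\<alpha> powr \<mu> * \<rho> \<le> c\<^sub>2 powr \<mu> * (\<delta> powr (2 * \<mu> / (2 * \<mu> + 1)) * \<rho> powr (1 / (2 * \<mu> + 1)))"
    and "\<alpha> powr (-1/2) * \<delta>
      \<le> c\<^sub>1 powr (-1/2) * (\<delta> powr (2 * \<mu> / (2 * \<mu> + 1)) * \<rho> powr (1 / (2 * \<mu> + 1)))"
proof -
  define s where "s = 1 / (2 * \<mu> + 1)"
  have s: "2 / (2 * \<mu> + 1) = 2 * s" "2 * \<mu> / (2 * \<mu> + 1) = 1 - s" "2 * \<mu> * s = 1 - s"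
    using \<open>\<mu> > 0\<close> by (auto simp: s_def field_simps)
  define r where "r = (\<delta> / \<rho>) powr (2 * s)"
  have r: "r > 0" "c\<^sub>1 * r \<le> \<alpha>" "\<alpha> \<le> c\<^sub>2 * r"
    using assms by (auto simp: r_def s)
  have "0 < c\<^sub>1 * r"
    using r(1) \<open>c\<^sub>1 > 0\<close> by simp
  then have "\<alpha> > 0"
    using r(2) by linarith
  have "r powr \<mu> * \<rho> = (\<delta> / \<rho>) powr (1 - s) * \<rho>"
    using s(3) by (simp add: r_def powr_powr mult_ac)
  also have "\<dots> = \<delta> powr (1 - s) * \<rho> powr s"
    using assms by (simp add: powr_divide powr_diff field_simps)
  finally have e1: "r powr \<mu> * \<rho> = \<delta> powr (1 - s) * \<rho> powr s" .
  have "r powr (-1/2) * \<delta> = (\<delta> / \<rho>) powr (- s) * \<delta>"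
    by (simp add: r_def powr_powr)
  also have "\<dots> = \<delta> powr (1 - s) * \<rho> powr s"
    using assms by (simp add: powr_divide powr_diff powr_minus field_simps)
  finally have e2: "r powr (-1/2) * \<delta> = \<delta> powr (1 - s) * \<rho> powr s" .
  have "\<alpha> powr \<mu> \<le> (c\<^sub>2 * r) powr \<mu>"
    using r \<open>\<alpha> > 0\<close> assms by (intro powr_mono2) auto
  then have "\<alpha> powr \<mu> * \<rho> \<le> (c\<^sub>2 * r) powr \<mu> * \<rho>"
    using assms by (intro mult_right_mono) auto
  also have "\<dots> = c\<^sub>2 powr \<mu> * (r powr \<mu> * \<rho>)"
    using assms r by (simp add: powr_mult)
  finally show "\<alpha> powr \<mu> * \<rho>
      \<le> c\<^sub>2 powr \<mu> * (\<delta> powr (2 * \<mu> / (2 * \<mu> + 1)) * \<rho> powr (1 / (2 * \<mu> + 1)))"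
    unfolding e1 s(2) s_def[symmetric] .
  have "\<alpha> powr (-1/2) \<le> (c\<^sub>1 * r) powr (-1/2)"
    using r \<open>0 < c\<^sub>1 * r\<close> by (intro powr_mono2') auto
  then have "\<alpha> powr (-1/2) * \<delta> \<le> (c\<^sub>1 * r) powr (-1/2) * \<delta>"
    using assms by (intro mult_right_mono) auto
  also have "\<dots> = c\<^sub>1 powr (-1/2) * (r powr (-1/2) * \<delta>)"
    using assms r by (simp add: powr_mult)
  finally show "\<alpha> powr (-1/2) * \<delta>
      \<le> c\<^sub>1 powr (-1/2) * (\<delta> powr (2 * \<mu> / (2 * \<mu> + 1)) * \<rho> powr (1 / (2 * \<mu> + 1)))"
    unfolding e2 s(2) s_def[symmetric] .
qed

theorem theorem3p8:
  fixes sX :: "'k::rc_scalar \<Rightarrow> 'x::{real_inner, complete_space} \<Rightarrow> 'x"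
    and ipX :: "'x \<Rightarrow> 'x \<Rightarrow> 'k"
    and sY :: "'k \<Rightarrow> 'y::{real_inner, complete_space} \<Rightarrow> 'y"
    and ipY :: "'y \<Rightarrow> 'y \<Rightarrow> 'k"
    and D :: "'x set" and K :: "'x \<Rightarrow> 'y"
    and \<Lambda> :: "'i set" and u ubar :: "'i \<Rightarrow> 'x" and v :: "'i \<Rightarrow> 'y" and \<kappa> :: "'i \<Rightarrow> real"
    and f :: "real \<Rightarrow> real \<Rightarrow> real" and \<mu> C\<^sub>\<mu> c\<^sub>1 c\<^sub>2 :: real
  assumes "hilbert_space sX ipX" and "hilbert_space sY ipY"
    and "closed_densely_defined_operator sX sY D K"
    and "countable \<Lambda>"
    and "regularizing_filter f"
    and "is_dfd sX ipX ipY D K \<Lambda> u v \<kappa>"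
    and "is_dual_frame sX ipX (orth_compl ipX (op_kernel D K)) \<Lambda> u ubar"
    and "\<mu> > 0"
    and R1: "(\<lambda>\<alpha>. sup_norm_pos (f \<alpha>)) \<in> O[at_right 0](\<lambda>\<alpha>. \<alpha> powr (-1/2))"
    and R2: "\<forall>\<alpha>>0. (SUP t\<in>{0<..}. ereal (t powr (2 * \<mu>) * \<bar>1 - t * f \<alpha> t\<bar>))
                     \<le> ereal (C\<^sub>\<mu> * \<alpha> powr \<mu>)"
    and "0 < c\<^sub>1" and "c\<^sub>1 \<le> c\<^sub>2"
  shows "\<exists>c\<^sub>\<mu>. \<forall>\<rho>>0. \<forall>\<alpha>s. parameter_choice_rate c\<^sub>1 c\<^sub>2 \<mu> \<rho> \<alpha>s \<longrightarrow>
           (\<forall>x \<in> D \<inter> orth_compl ipX (op_kernel D K). source_condition ipX \<Lambda> u \<kappa> \<mu> \<rho> x \<longrightarrow>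
             (\<forall>\<^sub>F \<delta> in at_right 0. \<forall>y. norm (y - K x) \<le> \<delta> \<longrightarrow>
                norm (x - filtered_dfd sX ipY \<Lambda> ubar v \<kappa> f (\<alpha>s \<delta> y) y)
                  \<le> c\<^sub>\<mu> * \<delta> powr (2 * \<mu> / (2 * \<mu> + 1)) * \<rho> powr (1 / (2 * \<mu> + 1))))"
proof -
  interpret X: hilbert_space sX ipX by fact
  interpret Y: hilbert_space sY ipY by fact
  have dense: "closure D = UNIV"
    using assms(3) by (simp add: closed_densely_defined_operator_def)
  have "Y.subspace (closure (K ` D))"
    using closed_densely_defined_operator_subspace_range[OF X.vector_space_axioms Y.vector_space_axioms assms(3)]
    by (rule Y.subspace_closure_scale)
  then obtain Bv where Bv: "Y.bessel_bound Bv \<Lambda> v"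
    using Y.frame_imp_bessel_bound assms(6) unfolding is_dfd_def by metis
  obtain Bu where Bu: "X.bessel_bound Bu \<Lambda> ubar"
    using X.frame_imp_bessel_bound[OF X.subspace_orth_compl] assms(7)
    unfolding is_dual_frame_def by metis
  have nonneg: "Bu \<ge> 0" "Bv \<ge> 0"
    using Bu Bv by (auto simp: X.bessel_bound_def Y.bessel_bound_def)
  have \<kappa>: "\<And>i. i \<in> \<Lambda> \<Longrightarrow> \<kappa> i > 0"
    using assms(6) by (simp add: is_dfd_def)
  have filter_le: "\<bar>f \<alpha> t\<bar> \<le> sup_norm_pos (f \<alpha>)" if "\<alpha> > 0" "t > 0" for \<alpha> t
    using assms(5) that unfolding regularizing_filter_def sup_norm_pos_def
    by (intro cSUP_upper) auto
  have qualif: "t powr (2 * \<mu>) * \<bar>1 - t * f \<alpha> t\<bar> \<le> C\<^sub>\<mu> * \<alpha> powr \<mu>" if "\<alpha> > 0" "t > 0" for \<alpha> t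
  proof -
    have "ereal (t powr (2 * \<mu>) * \<bar>1 - t * f \<alpha> t\<bar>)
        \<le> (SUP t\<in>{0<..}. ereal (t powr (2 * \<mu>) * \<bar>1 - t * f \<alpha> t\<bar>))"
      using that by (intro SUP_upper) auto
    also have "\<dots> \<le> ereal (C\<^sub>\<mu> * \<alpha> powr \<mu>)"
      using R2 that by blast
    finally show ?thesis by simp
  qed
  \<comment> \<open>The supremum at \<open>\<alpha> = 1\<close> dominates a nonnegative number.\<close>
  have C\<mu>: "C\<^sub>\<mu> \<ge> 0"
    using order_trans[OF _ qualif[of 1 1]] by simp
  obtain C where "C > 0"
    and "\<forall>\<^sub>F \<alpha> in at_right 0. norm (sup_norm_pos (f \<alpha>)) \<le> C * norm (\<alpha> powr (-1/2))"
    using landau_o.bigE[OF R1] by blast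
  then obtain \<epsilon> where "\<epsilon> > 0"
    and C: "\<And>\<alpha>. 0 < \<alpha> \<Longrightarrow> \<alpha> < \<epsilon> \<Longrightarrow> sup_norm_pos (f \<alpha>) \<le> C * \<alpha> powr (-1/2)"
    unfolding eventually_at_right_field by (auto simp: abs_le_iff)
  have "c\<^sub>2 > 0"
    using \<open>0 < c\<^sub>1\<close> \<open>c\<^sub>1 \<le> c\<^sub>2\<close> by simp
  define c where "c = Bu * (C\<^sub>\<mu> * c\<^sub>2 powr \<mu> + C * Bv * c\<^sub>1 powr (-1/2))"
  show ?thesis
  proof (rule exI[of _ c], intro allI ballI impI)
    fix \<rho> :: real and \<alpha>s :: "real \<Rightarrow> 'y \<Rightarrow> real" and x
    assume "\<rho> > 0" and choice: "parameter_choice_rate c\<^sub>1 c\<^sub>2 \<mu> \<rho> \<alpha>s"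
      and x: "x \<in> D \<inter> orth_compl ipX (op_kernel D K)"
      and source: "source_condition ipX \<Lambda> u \<kappa> \<mu> \<rho> x"
    have dual: "((\<lambda>i. sX (ipX x (u i)) (ubar i)) has_sum x) \<Lambda>"
      using assms(7) x by (simp add: is_dual_frame_def)
    \<comment> \<open>The range of \<open>\<alpha>\<close> on which \<open>R1\<close> yields its bound is reached as soon as the upper bound of the
      parameter choice is below \<open>\<epsilon>\<close>; this threshold for \<open>\<delta>\<close> is the same for all data.\<close>
    have "((\<lambda>\<delta>. c\<^sub>2 * (\<delta> / \<rho>) powr (2 / (2 * \<mu> + 1))) \<longlongrightarrow> c\<^sub>2 * 0) (at_right 0)"
    proof (intro tendsto_mult tendsto_const tendsto_zero_powrI)
      show "((\<lambda>\<delta>. \<delta> / \<rho>) \<longlongrightarrow> 0) (at_right 0)"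
        using \<open>\<rho> > 0\<close> by (auto intro!: tendsto_eq_intros)
      show "\<forall>\<^sub>F \<delta> in at_right 0. 0 \<le> \<delta> / \<rho>"
        using \<open>\<rho> > 0\<close> by (auto simp: eventually_at_right_field intro!: exI[of _ 1])
      show "0 < 2 / (2 * \<mu> + 1)"
        using \<open>\<mu> > 0\<close> by simp
    qed (rule tendsto_const)
    then have "\<forall>\<^sub>F \<delta> in at_right 0. c\<^sub>2 * (\<delta> / \<rho>) powr (2 / (2 * \<mu> + 1)) < \<epsilon>"
      using \<open>\<epsilon> > 0\<close> by (simp add: order_tendstoD(2))
    moreover have "\<forall>\<^sub>F \<delta> in at_right (0::real). \<delta> > 0"
      by (rule eventually_at_right_less)
    ultimately show "\<forall>\<^sub>F \<delta> in at_right 0. \<forall>y. norm (y - K x) \<le> \<delta> \<longrightarrow>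
        norm (x - filtered_dfd sX ipY \<Lambda> ubar v \<kappa> f (\<alpha>s \<delta> y) y)
          \<le> c * \<delta> powr (2 * \<mu> / (2 * \<mu> + 1)) * \<rho> powr (1 / (2 * \<mu> + 1))"
    proof eventually_elim
      case (elim \<delta>)
      show ?case
      proof (intro allI impI)
        fix y assume y: "norm (y - K x) \<le> \<delta>"
        define \<alpha> where "\<alpha> = \<alpha>s \<delta> y"
        define E where "E = \<delta> powr (2 * \<mu> / (2 * \<mu> + 1)) * \<rho> powr (1 / (2 * \<mu> + 1))"
        have \<alpha>: "\<alpha> > 0" "c\<^sub>1 * (\<delta> / \<rho>) powr (2 / (2 * \<mu> + 1)) \<le> \<alpha>"
            "\<alpha> \<le> c\<^sub>2 * (\<delta> / \<rho>) powr (2 / (2 * \<mu> + 1))"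
          using choice elim(2) by (auto simp: parameter_choice_rate_def \<alpha>_def)
        then have "\<alpha> < \<epsilon>"
          using elim(1) by linarith
        note balance = parameter_balance[OF \<open>\<mu> > 0\<close> \<open>\<rho> > 0\<close> elim(2) \<open>0 < c\<^sub>1\<close> \<open>c\<^sub>2 > 0\<close> \<alpha>(2,3),
            folded E_def]
        have "norm (x - filtered_dfd sX ipY \<Lambda> ubar v \<kappa> f \<alpha> y)
            \<le> Bu * (C\<^sub>\<mu> * \<alpha> powr \<mu> * \<rho> + C * \<alpha> powr (-1/2) * (Bv * norm (y - K x)))"
        proof (rule filtered_dfd_error[OF assms(1,2) Bu Bv dual _ source])
          show "ipY (K x) (v i) = of_real (\<kappa> i) * ipX x (u i)" if "i \<in> \<Lambda>" for i
            using dfd_coefficient[OF assms(1) dense assms(6)] x that by blast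
          show "\<bar>f \<alpha> (\<kappa> i)\<bar> \<le> C * \<alpha> powr (-1/2)" if "i \<in> \<Lambda>" for i
            using filter_le[OF \<alpha>(1) \<kappa>[OF that]] C[OF \<alpha>(1) \<open>\<alpha> < \<epsilon>\<close>] by (rule order_trans)
        qed (use qualif[OF \<alpha>(1) \<kappa>] C\<mu> \<open>C > 0\<close> in auto)
        also have "\<dots> \<le> Bu * (C\<^sub>\<mu> * \<alpha> powr \<mu> * \<rho> + C * \<alpha> powr (-1/2) * (Bv * \<delta>))"
          using y nonneg \<open>C > 0\<close> by (intro mult_left_mono add_left_mono) auto
        also have "\<dots> = Bu * (C\<^sub>\<mu> * (\<alpha> powr \<mu> * \<rho>) + C * Bv * (\<alpha> powr (-1/2) * \<delta>))"
          by (simp add: mult_ac)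
        also have "\<dots> \<le> Bu * (C\<^sub>\<mu> * (c\<^sub>2 powr \<mu> * E) + C * Bv * (c\<^sub>1 powr (-1/2) * E))"
          using nonneg C\<mu> \<open>C > 0\<close> balance by (intro mult_left_mono add_mono) auto
        also have "\<dots> = c * E"
          by (simp add: c_def algebra_simps)
        finally show "norm (x - filtered_dfd sX ipY \<Lambda> ubar v \<kappa> f (\<alpha>s \<delta> y) y)
          \<le> c * \<delta> powr (2 * \<mu> / (2 * \<mu> + 1)) * \<rho> powr (1 / (2 * \<mu> + 1))"
          by (simp add: \<alpha>_def E_def mult.assoc)
      qed
    qed
  qed
qed

end
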